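(* Let $\mathsf{K},\mathsf{L}$ be kernels on $S$ and assume that $\mathsf{K}$ is almost dominated by $\mathsf{L}$. Then for every $g\in\mathfrak{X}$ there exists a sequence $(g_n)_{n\in\mathbb{N}}\in\mathfrak{X}^{\mathbb{N}}$ such that $$\forall f\in\mathfrak{X}:\quad\sum_{s,t\in S}\langle f(t),\mathsf{K}(s,t)g(s)\rangle=\lim_{n\to+\infty}\sum_{s,t\in S}\langle f(t),\mathsf{L}(s,t)g_n(s)\rangle.$$
   Context: Let $S$ be a non-empty set and $\mathfrak{E}$ a complex Banach space with topological dual $\mathfrak{E}^{*}$. The dual pairing $\langle\cdot,\cdot\rangle:\mathfrak{E}\times\mathfrak{E}^{*}\to\mathbb{C}$ is taken linear in the first and conjugate linear in the second variable (the vector space structure of $\mathfrak{E}^*$ is chosen accordingly). $\mathbf{B}(\mathfrak{E},\mathfrak{E}^{*})$ is the space of bounded linear operators from $\mathfrak{E}$ to $\mathfrak{E}^*$. $\mathfrak{X}$ is the complex linear space of finitely supported functions $f:S\to\mathfrak{E}$. A kernel on $S$ is a function $\mathsf{K}:S\times S\to\mathbf{B}(\mathfrak{E},\mathfrak{E}^{*})$ with $\sum_{s,t\in S}\langle f(t),\mathsf{K}(s,t)f(s)\rangle\ge0$ for all $f\in\mathfrak{X}$. A form on $\mathfrak{X}$ is a map $\mathfrak{t}:\mathfrak{X}\times\mathfrak{X}\to\mathbb{C}$, linear in the first and antilinear in the second argument, with $\mathfrak{t}[x]:=\mathfrak{t}(x,x)\ge0$ for all $x$. Write $\mathfrak{t}\le\mathfrak{w}$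 if $\mathfrak{t}[x]\le\mathfrak{w}[x]$ for all $x$; $\mathfrak{t}$ is dominated by $\mathfrak{w}$ if $\mathfrak{t}\le c\,\mathfrak{w}$ for some constant $c$; $\mathfrak{t}$ is almost dominated by $\mathfrak{w}$ if there is a monotonically nondecreasing sequence of forms $\mathfrak{t}_n$, each dominated by $\mathfrak{w}$, with $\mathfrak{t}=\sup_n\mathfrak{t}_n$ (pointwise supremum of quadratic forms). The form associated with a kernel $\mathsf{K}$ is $\mathfrak{w}_{\mathsf{K}}(f,g)=\sum_{s,t\in S}\langle f(t),\mathsf{K}(s,t)g(s)\rangle$. A kernel $\mathsf{K}$ is almost dominated by $\mathsf{L}$ if $\mathfrak{w}_{\mathsf{K}}$ is almost dominated by $\mathfrak{w}_{\mathsf{L}}$. *)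

theory Defs
  imports
    "HOL-Analysis.Analysis"
    "HOL-Library.Poly_Mapping"
    "HOL-Library.Complex_Order"
begin

section \<open>Complex vector spaces and Banach spaces\<close>

class complex_vector = ab_group_add +
  fixes scaleC :: "complex \<Rightarrow> 'a \<Rightarrow> 'a"  (infixr \<open>*\<^sub>C\<close> 75)
  assumes scaleC_add_right: "a *\<^sub>C (x + y) = a *\<^sub>C x + a *\<^sub>C y"
    and scaleC_add_left: "(a + b) *\<^sub>C x = a *\<^sub>C x + b *\<^sub>C x"
    and scaleC_scaleC: "a *\<^sub>C b *\<^sub>C x = (a * b) *\<^sub>C x"
    and scaleC_one: "1 *\<^sub>C x = x"

class complex_normed_vector = complex_vector + real_normed_vector +
  assumes scaleR_scaleC: "r *\<^sub>R x = complex_of_real r *\<^sub>C x"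
    and norm_scaleC: "norm (a *\<^sub>C x) = cmod a * norm x"

class complex_banach = complex_normed_vector + complete_space

instantiation complex :: complex_banach
begin

definition scaleC_complex :: "complex \<Rightarrow> complex \<Rightarrow> complex" where
  "scaleC_complex a x = a * x"

instance
  by standard (auto simp: scaleC_complex_def algebra_simps scaleR_conv_of_real norm_mult)

end

definition clinear :: "('a::complex_vector \<Rightarrow> 'b::complex_vector) \<Rightarrow> bool" where
  "clinear f \<longleftrightarrow> (\<forall>x y. f (x + y) = f x + f y) \<and> (\<forall>c x. f (c *\<^sub>C x) = c *\<^sub>C f x)"

definition bounded_clinear ::
    "('a::complex_normed_vector \<Rightarrow> 'b::complex_normed_vector) \<Rightarrow> bool" where
  "bounded_clinear f \<longleftrightarrow> clinear f \<and> (\<exists>C. \<forall>x. norm (f x) \<le> C * norm x)"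

lemma clinear_zero: "clinear f \<Longrightarrow> f 0 = 0"
  unfolding clinear_def by (metis add_cancel_right_right)

lemma bounded_clinear_imp_bounded_linear:
  assumes "bounded_clinear f"
  shows "bounded_linear f"
proof -
  from assms obtain C where "\<And>x. norm (f x) \<le> C * norm x"
    by (auto simp: bounded_clinear_def)
  with assms show ?thesis
    by (intro bounded_linear_intro[where K = C])
      (auto simp: bounded_clinear_def clinear_def scaleR_scaleC mult.commute)
qed

lemma bounded_clinear_iff:
  "bounded_clinear f \<longleftrightarrow> bounded_linear f \<and> (\<forall>c x. f (c *\<^sub>C x) = c *\<^sub>C f x)"
proof
  assume "bounded_clinear f"
  then show "bounded_linear f \<and> (\<forall>c x. f (c *\<^sub>C x) = c *\<^sub>C f x)"
    using bounded_clinear_imp_bounded_linear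
    by (auto simp: bounded_clinear_def clinear_def)
next
  assume "bounded_linear f \<and> (\<forall>c x. f (c *\<^sub>C x) = c *\<^sub>C f x)"
  then have f: "bounded_linear f" "clinear f"
    by (auto simp: clinear_def linear_add bounded_linear.linear)
  from bounded_linear.bounded[OF f(1)] obtain C where "\<And>x. norm (f x) \<le> norm x * C"
    by blast
  then have "\<forall>x. norm (f x) \<le> C * norm x"
    by (simp add: mult.commute)
  with f(2) show "bounded_clinear f"
    by (auto simp: bounded_clinear_def)
qed


section \<open>The topological dual and the dual pairing\<close>

text \<open>
  The elements of the dual are the bounded complex-linear functionals.  Scalar multiplication is
  twisted by conjugation, so that the evaluation pairing is conjugate linear in its second
  argument.
\<close>

typedef (overloaded) 'a cdual =
  "{\<phi> :: 'a::complex_normed_vector \<Rightarrow> complex. bounded_clinear \<phi>}"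
  morphisms cdual_apply Abs_cdual
  by (rule exI[of _ "\<lambda>_. 0"]) (auto simp: bounded_clinear_iff scaleC_complex_def)

setup_lifting type_definition_cdual

definition pairing :: "'a::complex_normed_vector \<Rightarrow> 'a cdual \<Rightarrow> complex"
    (\<open>\<langle>_, _\<rangle>\<close>) where
  "\<langle>x, \<phi>\<rangle> = cdual_apply \<phi> x"

lemma cdual_cong: "(\<And>x. cdual_apply f x = cdual_apply g x) \<Longrightarrow> f = g"
  by (metis cdual_apply_inject ext)

lemma bounded_linear_cdual_apply: "bounded_linear (cdual_apply f)"
  using cdual_apply[of f] by (simp add: bounded_clinear_iff)

lemma onorm_cmult_complex:
  assumes "bounded_linear (f :: 'a::real_normed_vector \<Rightarrow> complex)"
  shows "onorm (\<lambda>x. c * f x) = cmod c * onorm f"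
proof (rule order_antisym)
  have le: "onorm (\<lambda>x. d * g x) \<le> cmod d * onorm g"
    if "bounded_linear g" for d and g :: "'a \<Rightarrow> complex"
  proof (rule onorm_bound)
    show "0 \<le> cmod d * onorm g"
      using that by (simp add: onorm_pos_le)
    show "norm (d * g x) \<le> cmod d * onorm g * norm x" for x
      using onorm[OF that, of x] by (simp add: norm_mult mult.assoc mult_left_mono)
  qed
  show "onorm (\<lambda>x. c * f x) \<le> cmod c * onorm f"
    by (rule le[OF assms])
  show "cmod c * onorm f \<le> onorm (\<lambda>x. c * f x)"
  proof (cases "c = 0")
    case True
    then show ?thesis by (simp add: onorm_zero)
  next
    case False
    have "onorm (\<lambda>x. inverse c * (c * f x)) \<le> cmod (inverse c) * onorm (\<lambda>x. c * f x)"
      by (rule le) (rule bounded_linear_const_mult[OF assms])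
    with False have "onorm f \<le> cmod (inverse c) * onorm (\<lambda>x. c * f x)"
      by (simp add: mult.assoc[symmetric])
    with False show ?thesis
      by (simp add: norm_divide field_simps)
  qed
qed

instantiation cdual :: (complex_normed_vector) complex_normed_vector
begin

lift_definition zero_cdual :: "'a cdual" is "\<lambda>_. 0"
  by (auto simp: bounded_clinear_iff scaleC_complex_def)

lift_definition plus_cdual :: "'a cdual \<Rightarrow> 'a cdual \<Rightarrow> 'a cdual" is "\<lambda>f g x. f x + g x"
  by (auto simp: bounded_clinear_iff scaleC_complex_def algebra_simps intro: bounded_linear_add)

lift_definition minus_cdual :: "'a cdual \<Rightarrow> 'a cdual \<Rightarrow> 'a cdual" is "\<lambda>f g x. f x - g x"
  by (auto simp: bounded_clinear_iff scaleC_complex_def algebra_simps intro: bounded_linear_sub)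

lift_definition uminus_cdual :: "'a cdual \<Rightarrow> 'a cdual" is "\<lambda>f x. - f x"
  by (auto simp: bounded_clinear_iff scaleC_complex_def intro: bounded_linear_minus)

lift_definition scaleC_cdual :: "complex \<Rightarrow> 'a cdual \<Rightarrow> 'a cdual" is "\<lambda>c f x. cnj c * f x"
  by (auto simp: bounded_clinear_iff scaleC_complex_def intro: bounded_linear_const_mult)

definition scaleR_cdual :: "real \<Rightarrow> 'a cdual \<Rightarrow> 'a cdual" where
  "scaleR_cdual r f = complex_of_real r *\<^sub>C f"

lift_definition norm_cdual :: "'a cdual \<Rightarrow> real" is onorm .

definition dist_cdual :: "'a cdual \<Rightarrow> 'a cdual \<Rightarrow> real" where
  "dist_cdual f g = norm (f - g)"

definition sgn_cdual :: "'a cdual \<Rightarrow> 'a cdual" where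
  "sgn_cdual f = inverse (norm f) *\<^sub>R f"

definition uniformity_cdual :: "('a cdual \<times> 'a cdual) filter" where
  "uniformity_cdual = (INF e\<in>{0<..}. principal {(f, g). dist f g < e})"

definition open_cdual :: "'a cdual set \<Rightarrow> bool" where
  "open_cdual U \<longleftrightarrow> (\<forall>x\<in>U. \<forall>\<^sub>F (x', y) in uniformity. x' = x \<longrightarrow> y \<in> U)"

instance
proof
  fix a b :: complex and r s :: real and f g h :: "'a cdual" and U :: "'a cdual set"
  show "f + g + h = f + (g + h)" "f + g = g + f" "0 + f = f" "- f + f = 0" "f - g = f + - g"
    by (transfer; simp add: algebra_simps)+
  show C1: "a *\<^sub>C (f + g) = a *\<^sub>C f + a *\<^sub>C g" "(a + b) *\<^sub>C f = a *\<^sub>C f + b *\<^sub>C f"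
    "a *\<^sub>C b *\<^sub>C f = (a * b) *\<^sub>C f" "1 *\<^sub>C f = f"
    for a b and f g :: "'a cdual"
    by (transfer; simp add: algebra_simps)+
  show "r *\<^sub>R (f + g) = r *\<^sub>R f + r *\<^sub>R g" "(r + s) *\<^sub>R f = r *\<^sub>R f + s *\<^sub>R f"
    "r *\<^sub>R s *\<^sub>R f = (r * s) *\<^sub>R f" "1 *\<^sub>R f = f"
    by (simp_all add: scaleR_cdual_def C1)
  show R: "r *\<^sub>R f = complex_of_real r *\<^sub>C f" for r and f :: "'a cdual"
    by (rule scaleR_cdual_def)
  show N: "norm (a *\<^sub>C f) = cmod a * norm f" for a and f :: "'a cdual"
    by transfer (simp add: onorm_cmult_complex bounded_clinear_imp_bounded_linear)
  show "norm (r *\<^sub>R f) = \<bar>r\<bar> * norm f"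
    by (simp add: R N)
  show "norm (f + g) \<le> norm f + norm g"
    by transfer (simp add: onorm_triangle bounded_clinear_imp_bounded_linear)
  show "norm f = 0 \<longleftrightarrow> f = 0"
    by transfer (simp add: onorm_eq_0 bounded_clinear_imp_bounded_linear fun_eq_iff)
  show "dist f g = norm (f - g)"
    by (rule dist_cdual_def)
  show "sgn f = inverse (norm f) *\<^sub>R f"
    by (rule sgn_cdual_def)
  show "(uniformity :: ('a cdual \<times> 'a cdual) filter)
      = (INF e\<in>{0<..}. principal {(f, g). dist f g < e})"
    by (rule uniformity_cdual_def)
  show "open U \<longleftrightarrow> (\<forall>x\<in>U. \<forall>\<^sub>F (x', y) in uniformity. x' = x \<longrightarrow> y \<in> U)"
    by (rule open_cdual_def)
qed

end

lemma pairing_add_left: "\<langle>x + y, \<phi>\<rangle> = \<langle>x, \<phi>\<rangle> + \<langle>y, \<phi>\<rangle>"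
  and pairing_scaleC_left: "\<langle>c *\<^sub>C x, \<phi>\<rangle> = c * \<langle>x, \<phi>\<rangle>"
  using cdual_apply[of \<phi>]
  by (auto simp: pairing_def bounded_clinear_def clinear_def scaleC_complex_def)

lemma pairing_add_right: "\<langle>x, \<phi> + \<psi>\<rangle> = \<langle>x, \<phi>\<rangle> + \<langle>x, \<psi>\<rangle>"
  by (simp add: pairing_def plus_cdual.rep_eq)

lemma pairing_scaleC_right: "\<langle>x, c *\<^sub>C \<phi>\<rangle> = cnj c * \<langle>x, \<phi>\<rangle>"
  by (simp add: pairing_def scaleC_cdual.rep_eq)


section \<open>Finitely supported functions\<close>

lemma scaleC_zero: "c *\<^sub>C (0 :: 'a::complex_vector) = 0"
  by (metis add_cancel_right_right scaleC_add_right)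

instantiation poly_mapping :: (type, complex_vector) complex_vector
begin

lift_definition scaleC_poly_mapping :: "complex \<Rightarrow> ('a \<Rightarrow>\<^sub>0 'b) \<Rightarrow> ('a \<Rightarrow>\<^sub>0 'b)"
  is "\<lambda>c f s. c *\<^sub>C f s"
proof -
  fix c and f :: "'a \<Rightarrow> 'b"
  assume "finite {s. f s \<noteq> 0}"
  then show "finite {s. c *\<^sub>C f s \<noteq> 0}"
    by (rule rev_finite_subset) (auto simp: scaleC_zero)
qed

instance
  by standard (transfer; simp add: scaleC_add_right scaleC_add_left scaleC_scaleC scaleC_one)+

end


section \<open>Forms\<close>

text \<open>
  The order on \<^typ>\<open>complex\<close> is the one of \<^theory>\<open>HOL-Library.Complex_Order\<close>: \<open>0 \<le> z\<close> means
  that \<open>z\<close> is real and nonnegative.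
\<close>

definition is_form :: "('x::complex_vector \<Rightarrow> 'x \<Rightarrow> complex) \<Rightarrow> bool" where
  "is_form t \<longleftrightarrow>
     (\<forall>x y z. t (x + y) z = t x z + t y z) \<and>
     (\<forall>c x z. t (c *\<^sub>C x) z = c * t x z) \<and>
     (\<forall>x y z. t x (y + z) = t x y + t x z) \<and>
     (\<forall>c x z. t x (c *\<^sub>C z) = cnj c * t x z) \<and>
     (\<forall>x. 0 \<le> t x x)"

definition quad :: "('x \<Rightarrow> 'x \<Rightarrow> complex) \<Rightarrow> 'x \<Rightarrow> real" where
  "quad t x = Re (t x x)"

definition form_le :: "('x \<Rightarrow> 'x \<Rightarrow> complex) \<Rightarrow> ('x \<Rightarrow> 'x \<Rightarrow> complex) \<Rightarrow> bool" where
  "form_le t w \<longleftrightarrow> (\<forall>x. quad t x \<le> quad w x)"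

definition form_dominated :: "('x \<Rightarrow> 'x \<Rightarrow> complex) \<Rightarrow> ('x \<Rightarrow> 'x \<Rightarrow> complex) \<Rightarrow> bool" where
  "form_dominated t w \<longleftrightarrow> (\<exists>c::real. 0 \<le> c \<and> form_le t (\<lambda>x y. complex_of_real c * w x y))"

text \<open>
  The supremum of the quadratic forms is taken in the extended reals, because the supremum of an
  unbounded set of reals is unspecified; the equation then says in particular that it is finite.
\<close>

definition form_almost_dominated ::
    "('x::complex_vector \<Rightarrow> 'x \<Rightarrow> complex) \<Rightarrow> ('x \<Rightarrow> 'x \<Rightarrow> complex) \<Rightarrow> bool" where
  "form_almost_dominated t w \<longleftrightarrow>
     (\<exists>T :: nat \<Rightarrow> 'x \<Rightarrow> 'x \<Rightarrow> complex.
        (\<forall>n. is_form (T n)) \<and>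
        (\<forall>n. form_le (T n) (T (Suc n))) \<and>
        (\<forall>n. form_dominated (T n) w) \<and>
        (\<forall>x. ereal (quad t x) = (SUP n. ereal (quad (T n) x))))"


section \<open>Kernels\<close>

text \<open>
  The set on which the kernels live is the type \<open>'s\<close>.  The sum below has only finitely many
  nonzero terms; \<^const>\<open>Sum_any\<close> is the sum over the whole type of such a family.
\<close>

definition kernel_form ::
    "('s \<Rightarrow> 's \<Rightarrow> 'e::complex_banach \<Rightarrow> 'e cdual) \<Rightarrow> ('s \<Rightarrow>\<^sub>0 'e) \<Rightarrow> ('s \<Rightarrow>\<^sub>0 'e) \<Rightarrow> complex" where
  "kernel_form K f g = Sum_any (\<lambda>(s, t). \<langle>Poly_Mapping.lookup f t, K s t (Poly_Mapping.lookup g s)\<rangle>)"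

definition is_kernel :: "('s \<Rightarrow> 's \<Rightarrow> 'e::complex_banach \<Rightarrow> 'e cdual) \<Rightarrow> bool" where
  "is_kernel K \<longleftrightarrow> (\<forall>s t. bounded_clinear (K s t)) \<and>
     (\<forall>f. 0 \<le> Sum_any (\<lambda>(s, t). \<langle>Poly_Mapping.lookup f t, K s t (Poly_Mapping.lookup f s)\<rangle>))"

definition kernel_almost_dominated ::
    "('s \<Rightarrow> 's \<Rightarrow> 'e::complex_banach \<Rightarrow> 'e cdual) \<Rightarrow> ('s \<Rightarrow> 's \<Rightarrow> 'e \<Rightarrow> 'e cdual) \<Rightarrow> bool" where
  "kernel_almost_dominated K L \<longleftrightarrow> form_almost_dominated (kernel_form K) (kernel_form L)"

lemma kernel_form_eq_sum_keys:
  assumes "is_kernel K"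
  shows "kernel_form K f g =
    (\<Sum>(s, t)\<in>Poly_Mapping.keys g \<times> Poly_Mapping.keys f. \<langle>Poly_Mapping.lookup f t, K s t (Poly_Mapping.lookup g s)\<rangle>)"
  unfolding kernel_form_def
proof (rule Sum_any.expand_superset)
  have K0: "K s t 0 = 0" for s t
    using assms by (simp add: is_kernel_def bounded_clinear_def clinear_zero)
  have "\<langle>0, \<phi>\<rangle> = 0" "\<langle>x, 0\<rangle> = 0" for x :: 'b and \<phi> :: "'b cdual"
    by (simp_all add: pairing_def zero_cdual.rep_eq linear_0 bounded_linear.linear
        bounded_linear_cdual_apply)
  then show "{p. (case p of (s, t) \<Rightarrow> \<langle>Poly_Mapping.lookup f t, K s t (Poly_Mapping.lookup g s)\<rangle>) \<noteq> 0}
      \<subseteq> Poly_Mapping.keys g \<times> Poly_Mapping.keys f"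
    by (auto simp: in_keys_iff K0)
qed auto

end

theory Submission
  imports Defs
begin

text \<open>
  If \<open>T \<le> c w\<close>, then \<open>T(\<cdot>, g)\<close> is \<open>w\<close>-bounded, so by the Riesz theorem it is represented by an element
  of the completion of \<open>w\<close>, which can be approximated by elements of the original space. The
  completion is avoided by taking an approximate minimiser \<open>h\<close> of \<open>w[h] - 2 Re T(h, g)\<close>, which makes
  \<open>w(\<cdot>, h)\<close> close to \<open>T(\<cdot>, g)\<close>. Applying this with error \<open>1/(n+1)\<close> to the \<open>n\<close>-th dominated form, and
  using that these forms converge to \<open>t\<close> by polarization, gives the required sequence.
\<close>

lemma
  assumes "is_form t"
  shows form_add_left: "t (x + y) z = t x z + t y z"
    and form_scaleC_left: "t (c *\<^sub>C x) z = c * t x z"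
    and form_add_right: "t z (x + y) = t z x + t z y"
    and form_scaleC_right: "t z (c *\<^sub>C x) = cnj c * t z x"
    and form_nonneg: "0 \<le> t x x"
  using assms by (auto simp: is_form_def)

lemma quad_nonneg: "is_form t \<Longrightarrow> 0 \<le> quad t x"
  using form_nonneg[of t x] by (simp add: quad_def less_eq_complex_def)

text \<open>Positivity forces the diagonal values to be real. Expanding them at \<open>x + y\<close>
  and at \<open>x + \<i> *\<^sub>C y\<close> compares the imaginary and the real parts of
  \<open>t x y\<close> and \<open>t y x\<close>.\<close>

lemma form_hermitian:
  assumes "is_form t"
  shows "t y x = cnj (t x y)"
proof -
  note form = form_add_left[OF assms] form_add_right[OF assms]
    form_scaleC_left[OF assms] form_scaleC_right[OF assms]
  have real: "Im (t z z) = 0" for z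
    using form_nonneg[OF assms, of z] by (simp add: less_eq_complex_def)
  have "Im (t x y) + Im (t y x) = 0"
    using real[of "x + y"] real[of x] real[of y] by (simp add: form)
  moreover have "Re (t y x) - Re (t x y) = 0"
    using real[of "x + \<i> *\<^sub>C y"] real[of x] real[of y] by (simp add: form)
  ultimately show ?thesis
    by (simp add: complex_eq_iff)
qed

lemma quad_add_scale:
  assumes "is_form t"
  shows "quad t (x + complex_of_real s *\<^sub>C y) = quad t x + 2 * s * Re (t y x) + s\<^sup>2 * quad t y"
  using form_hermitian[OF assms, of x y]
  by (simp add: quad_def form_add_left[OF assms] form_add_right[OF assms]
      form_scaleC_left[OF assms] form_scaleC_right[OF assms] power2_eq_square algebra_simps)

lemma Re_form_polarization:
  assumes "is_form t"
  shows "Re (t x y) = (quad t (y + 1 *\<^sub>C x) - quad t (y + (-1) *\<^sub>C x)) / 4"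
  using quad_add_scale[OF assms, of y 1 x] quad_add_scale[OF assms, of y "-1" x] by simp

text \<open>Rotating the first argument turns statements about real parts into statements about
  imaginary parts.\<close>

lemma Im_form_eq_Re:
  assumes "is_form t"
  shows "Im (t x y) = Re (t ((-\<i>) *\<^sub>C x) y)"
  by (simp add: form_scaleC_left[OF assms])

lemma form_tendsto:
  assumes T: "\<And>n. is_form (T n)" and t: "is_form t"
    and lim: "\<And>x. (\<lambda>n. quad (T n) x) \<longlonglongrightarrow> quad t x"
  shows "(\<lambda>n. T n x y) \<longlonglongrightarrow> t x y"
proof -
  have Re: "(\<lambda>n. Re (T n x y)) \<longlonglongrightarrow> Re (t x y)" for x y
    unfolding Re_form_polarization[OF T] Re_form_polarization[OF t] by (intro tendsto_intros lim) simp
  moreover have "(\<lambda>n. Im (T n x y)) \<longlonglongrightarrow> Im (t x y)"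
    unfolding Im_form_eq_Re[OF T] Im_form_eq_Re[OF t] by (rule Re)
  ultimately show ?thesis
    by (simp add: tendsto_complex_iff)
qed

lemma square_le_if_quadratic_nonneg:
  fixes a b c :: real
  assumes "0 \<le> a" and nonneg: "\<And>s. 0 \<le> a * s\<^sup>2 + 2 * s * b + c"
  shows "b\<^sup>2 \<le> a * c"
proof (cases "a = 0")
  case True
  have "b = 0"
  proof (rule ccontr)
    assume "b \<noteq> 0"
    then show False
      \<comment> \<open>At this \<open>s\<close> the expression, affine since \<open>a = 0\<close>,
        takes the value -1.\<close>
      using nonneg[of "- (c + 1) / (2 * b)"] True by (simp add: field_simps)
  qed
  then show ?thesis
    using True by simp
next
  case False
  with assms(1) have "0 < a" by simp
  then show ?thesis
    \<comment> \<open>This is the minimiser of the quadratic; the minimum is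
      \<open>c - b\<^sup>2 / a\<close>.\<close>
    using nonneg[of "- b / a"] by (simp add: field_simps power2_eq_square)
qed

text \<open>Domination bounds \<open>J\<close> from below, so approximate minimisers exist. Varying
  such an \<open>h\<close> in direction \<open>f\<close> gives a real quadratic that stays
  nonnegative after adding \<open>\<epsilon>\<close>; its discriminant yields the bound, with one
  \<open>h\<close> for all \<open>f\<close>.\<close>

lemma dominated_functional_approx:
  assumes T: "is_form T" and w: "is_form w" and dom: "form_dominated T w" and "0 < \<epsilon>"
  obtains h where "\<And>f. (Re (w f h - T f g))\<^sup>2 \<le> quad w f * \<epsilon>"
proof -
  define J where "J h = quad w h - 2 * Re (T h g)" for h
  obtain c where "0 \<le> c" and c: "\<And>x. quad T x \<le> c * quad w x"
    using dom by (auto simp: form_dominated_def form_le_def quad_def)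
  have "- ((c + 1) * quad T g) \<le> J h" for h
  proof -
    \<comment> \<open>Weighted Young inequality, from positivity of \<open>T\<close> at
      \<open>g - h / (c + 1)\<close>. The weight \<open>c + 1\<close> instead of \<open>c\<close>
      keeps the division meaningful when \<open>c = 0\<close>.\<close>
    have "0 \<le> (c + 1) * quad T g + 2 * (-1) * Re (T h g) + quad T h / (c + 1)"
    proof -
      have "0 \<le> (c + 1) * quad T (g + complex_of_real (- 1 / (c + 1)) *\<^sub>C h)"
        using \<open>0 \<le> c\<close> quad_nonneg[OF T] by (intro mult_nonneg_nonneg) simp_all
      also have "\<dots> = (c + 1) * quad T g + 2 * (-1) * Re (T h g) + quad T h / (c + 1)"
        unfolding quad_add_scale[OF T] using \<open>0 \<le> c\<close>
        by (simp add: divide_simps) (simp add: power2_eq_square algebra_simps)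
      finally show ?thesis .
    qed
    moreover have "quad T h / (c + 1) \<le> quad w h"
      using c[of h] \<open>0 \<le> c\<close> quad_nonneg[OF w, of h] by (simp add: field_simps)
    ultimately show ?thesis
      by (simp add: J_def)
  qed
  then have bdd: "bdd_below (range J)"
    by (auto intro!: bdd_belowI)
  obtain h where h: "J h < (INF h. J h) + \<epsilon>"
    using cInf_lessD[of "range J" "(INF h. J h) + \<epsilon>"] \<open>0 < \<epsilon>\<close> by auto
  have "(Re (w f h - T f g))\<^sup>2 \<le> quad w f * \<epsilon>" for f
  proof (rule square_le_if_quadratic_nonneg[OF quad_nonneg[OF w]])
    fix s :: real
    \<comment> \<open>No value of \<open>J\<close> is below its infimum, and \<open>J h\<close>
      exceeds that infimum by less than \<open>\<epsilon>\<close>.\<close>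
    have "J h < J (h + complex_of_real s *\<^sub>C f) + \<epsilon>"
      using h cINF_lower[OF bdd, of "h + complex_of_real s *\<^sub>C f"] by simp
    then show "0 \<le> quad w f * s\<^sup>2 + 2 * s * Re (w f h - T f g) + \<epsilon>"
      by (simp add: J_def quad_add_scale[OF w] form_add_left[OF T] form_scaleC_left[OF T]
          algebra_simps)
  qed
  then show thesis
    by (rule that)
qed

theorem almost_dominated_form_approx:
  assumes t: "is_form t" and w: "is_form w" and "form_almost_dominated t w"
  obtains h where "\<And>f. (\<lambda>n. w f (h n)) \<longlonglongrightarrow> t f g"
proof -
  from assms(3) obtain T where T: "\<And>n. is_form (T n)"
    and mono: "\<And>n. form_le (T n) (T (Suc n))" and dom: "\<And>n. form_dominated (T n) w"
    and sup: "\<And>x. ereal (quad t x) = (SUP n. ereal (quad (T n) x))"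
    by (auto simp: form_almost_dominated_def)
  \<comment> \<open>A nondecreasing sequence tends to its supremum; as this supremum is a real
    number, the convergence passes from the extended reals to the reals.\<close>
  have "(\<lambda>n. ereal (quad (T n) x)) \<longlonglongrightarrow> ereal (quad t x)" for x
    unfolding sup using mono by (intro LIMSEQ_SUP incseq_SucI) (simp add: form_le_def)
  then have T_lim: "(\<lambda>n. T n f g) \<longlonglongrightarrow> t f g" for f
    using T t by (intro form_tendsto) simp_all
  \<comment> \<open>The index \<open>n\<close> selects both the form and the error. Since
    \<open>h\<close> does not depend on \<open>f\<close>, choosing one for each \<open>n\<close>
    gives a single sequence for all \<open>f\<close>.\<close>
  have "\<exists>h. \<forall>f. (Re (w f h - T n f g))\<^sup>2 \<le> quad w f * (1 / real (Suc n))" for n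
  proof -
    have "0 < 1 / real (Suc n)" by simp
    from dominated_functional_approx[OF T w dom this] show ?thesis
      by blast
  qed
  then obtain h where h: "\<And>n f. (Re (w f (h n) - T n f g))\<^sup>2 \<le> quad w f * (1 / real (Suc n))"
    by metis
  have Re: "(\<lambda>n. Re (w f (h n) - T n f g)) \<longlonglongrightarrow> 0" for f
  proof -
    have bound: "(\<lambda>n. quad w f * (1 / real (Suc n))) \<longlonglongrightarrow> 0"
      using tendsto_mult[OF tendsto_const LIMSEQ_inverse_real_of_nat, of "quad w f"]
      by (simp add: inverse_eq_divide)
    have "(\<lambda>n. (Re (w f (h n) - T n f g))\<^sup>2) \<longlonglongrightarrow> 0"
      by (rule tendsto_sandwich[OF always_eventually always_eventually tendsto_const bound])
        (intro allI zero_le_power2 h)+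
    then have "(\<lambda>n. sqrt ((Re (w f (h n) - T n f g))\<^sup>2)) \<longlonglongrightarrow> sqrt 0"
      by (rule tendsto_real_sqrt)
    then show ?thesis
      by (simp add: tendsto_rabs_zero_iff)
  qed
  have "(\<lambda>n. w f (h n) - T n f g) \<longlonglongrightarrow> 0" for f
  proof -
    \<comment> \<open>The real-part limit holds for every first argument, in particular for
      \<open>(-\<i>) *\<^sub>C f\<close>.\<close>
    have "(\<lambda>n. Im (w f (h n) - T n f g)) \<longlonglongrightarrow> 0"
      using Re[of "(-\<i>) *\<^sub>C f"] by (simp add: form_scaleC_left[OF w] form_scaleC_left[OF T])
    with Re[of f] show ?thesis
      by (simp add: tendsto_complex_iff)
  qed
  then have "(\<lambda>n. w f (h n)) \<longlonglongrightarrow> t f g" for f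
    using tendsto_add[OF _ T_lim[of f], of "\<lambda>n. w f (h n) - T n f g" 0] by simp
  then show thesis
    by (rule that)
qed

lemma pairing_zero: "\<langle>0, \<phi>\<rangle> = 0" "\<langle>x, 0\<rangle> = 0"
  by (simp_all add: pairing_def zero_cdual.rep_eq linear_0 bounded_linear.linear
      bounded_linear_cdual_apply)

text \<open>Terms outside the supports vanish. The freedom in \<open>A\<close> and \<open>B\<close>
  allows sums for different functions to be taken over one common index set.\<close>

lemma kernel_form_eq_sum:
  assumes K: "is_kernel K"
    and fin: "finite A" "finite B"
    and sub: "Poly_Mapping.keys g \<subseteq> A" "Poly_Mapping.keys f \<subseteq> B"
  shows "kernel_form K f g =
    (\<Sum>(s, t)\<in>A \<times> B. \<langle>Poly_Mapping.lookup f t, K s t (Poly_Mapping.lookup g s)\<rangle>)"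
proof -
  have "K s t 0 = 0" for s t
    using K by (simp add: is_kernel_def bounded_clinear_def clinear_zero)
  then show ?thesis
    unfolding kernel_form_eq_sum_keys[OF K] using fin sub
    by (intro sum.mono_neutral_left) (auto simp: in_keys_iff pairing_zero)
qed

lemma is_form_kernel_form:
  assumes K: "is_kernel K"
  shows "is_form (kernel_form K)"
proof -
  have K_add: "K s t (x + y) = K s t x + K s t y"
    and K_scaleC: "K s t (c *\<^sub>C x) = c *\<^sub>C K s t x" for s t x y c
    using K by (auto simp: is_kernel_def bounded_clinear_def clinear_def)
  have keys_scaleC: "Poly_Mapping.keys (c *\<^sub>C f) \<subseteq> Poly_Mapping.keys f"
    for c and f :: "'a \<Rightarrow>\<^sub>0 'b"
    by (auto simp: in_keys_iff scaleC_poly_mapping.rep_eq scaleC_zero)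
  note simps = split_def lookup_add scaleC_poly_mapping.rep_eq K_add K_scaleC
    pairing_add_left pairing_scaleC_left pairing_add_right pairing_scaleC_right
    sum.distrib sum_distrib_left
  show ?thesis
    unfolding is_form_def
  proof (intro conjI allI)
    fix x y z :: "'a \<Rightarrow>\<^sub>0 'b" and c :: complex
    \<comment> \<open>Over this common finite set all the sums can be compared term by term. The
      conjugate in the second argument comes from the twisted scalar multiplication of the
      dual.\<close>
    let ?A = "Poly_Mapping.keys x \<union> Poly_Mapping.keys y \<union> Poly_Mapping.keys z"
    have eq: "kernel_form K f g =
        (\<Sum>(s, t)\<in>?A \<times> ?A. \<langle>Poly_Mapping.lookup f t, K s t (Poly_Mapping.lookup g s)\<rangle>)"
      if "Poly_Mapping.keys f \<subseteq> ?A" "Poly_Mapping.keys g \<subseteq> ?A" for f g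
      using that by (intro kernel_form_eq_sum[OF K]) auto
    have sub: "Poly_Mapping.keys x \<subseteq> ?A" "Poly_Mapping.keys y \<subseteq> ?A" "Poly_Mapping.keys z \<subseteq> ?A"
      "Poly_Mapping.keys (x + y) \<subseteq> ?A" "Poly_Mapping.keys (y + z) \<subseteq> ?A"
      "Poly_Mapping.keys (c *\<^sub>C x) \<subseteq> ?A" "Poly_Mapping.keys (c *\<^sub>C z) \<subseteq> ?A"
      using keys_add[of x y] keys_add[of y z] keys_scaleC[of c x] keys_scaleC[of c z] by auto
    show "kernel_form K (x + y) z = kernel_form K x z + kernel_form K y z"
      "kernel_form K (c *\<^sub>C x) z = c * kernel_form K x z"
      "kernel_form K x (y + z) = kernel_form K x y + kernel_form K x z"
      "kernel_form K x (c *\<^sub>C z) = cnj c * kernel_form K x z"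
      by (simp_all only: eq[OF sub(4,3)] eq[OF sub(1,3)] eq[OF sub(2,3)] eq[OF sub(6,3)]
          eq[OF sub(1,5)] eq[OF sub(1,2)] eq[OF sub(1,7)] simps)
    show "0 \<le> kernel_form K x x"
      using K by (simp add: is_kernel_def kernel_form_def)
  qed
qed

theorem corollary2p5:
  fixes K L :: "'s \<Rightarrow> 's \<Rightarrow> 'e::complex_banach \<Rightarrow> 'e cdual"
  assumes "is_kernel K" and "is_kernel L"
    and "kernel_almost_dominated K L"
  shows "\<forall>g :: 's \<Rightarrow>\<^sub>0 'e. \<exists>gs :: nat \<Rightarrow> ('s \<Rightarrow>\<^sub>0 'e). \<forall>f :: 's \<Rightarrow>\<^sub>0 'e.
    (\<lambda>n. Sum_any (\<lambda>(s, t). \<langle>Poly_Mapping.lookup f t, L s t (Poly_Mapping.lookup (gs n) s)\<rangle>))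
      \<longlonglongrightarrow> Sum_any (\<lambda>(s, t). \<langle>Poly_Mapping.lookup f t, K s t (Poly_Mapping.lookup g s)\<rangle>)"
proof
  fix g :: "'s \<Rightarrow>\<^sub>0 'e"
  \<comment> \<open>Both kernels induce forms, so the approximation result for forms on the space of
    finitely supported functions applies.\<close>
  obtain gs where "\<And>f. (\<lambda>n. kernel_form L f (gs n)) \<longlonglongrightarrow> kernel_form K f g"
    using almost_dominated_form_approx[OF is_form_kernel_form[OF assms(1)]
        is_form_kernel_form[OF assms(2)] assms(3)[unfolded kernel_almost_dominated_def], of g]
    by blast
  then show "\<exists>gs :: nat \<Rightarrow> ('s \<Rightarrow>\<^sub>0 'e). \<forall>f :: 's \<Rightarrow>\<^sub>0 'e.
    (\<lambda>n. Sum_any (\<lambda>(s, t). \<langle>Poly_Mapping.lookup f t, L s t (Poly_Mapping.lookup (gs n) s)\<rangle>))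
      \<longlonglongrightarrow> Sum_any (\<lambda>(s, t). \<langle>Poly_Mapping.lookup f t, K s t (Poly_Mapping.lookup g s)\<rangle>)"
    unfolding kernel_form_def by (intro exI allI)
qed

end
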